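(* Every $n$-node directed graph $G=(V,E)$ and every set $P \subseteq V \times V$ of node pairs has a reachability preserver on $O\left(n + (n|P|)^{2/3}\right)$ edges.
   Context: For a directed graph $G=(V,E)$ and a set of node pairs $P \subseteq V \times V$, a reachability preserver of $G,P$ is a subgraph $H=(V,E')$ with $E' \subseteq E$ such that for all $(s,t) \in P$, $H$ contains a directed path from $s$ to $t$ if and only if $G$ does. *)

theory Defs
  imports Complex_Main "Graph_Theory.Graph_Theory"
begin

text \<open>
  A directed graph \<open>(V, E)\<close> with \<open>E \<subseteq> V \<times> V\<close> is a \<open>pair_pre_digraph\<close>, so there are no parallel
  edges, but loops are allowed. \<open>spanning\<close> says that \<open>H\<close> is a subgraph of \<open>G\<close> on the full vertex
  set, and \<open>reachable\<close> includes the empty path from a vertex to itself.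
\<close>

definition reachability_preserver ::
    "'a pair_pre_digraph \<Rightarrow> ('a \<times> 'a) set \<Rightarrow> 'a pair_pre_digraph \<Rightarrow> bool" where
  "reachability_preserver G P H \<longleftrightarrow>
     spanning (with_proj H) (with_proj G) \<and>
     (\<forall>(s, t) \<in> P. reachable (with_proj H) s t \<longleftrightarrow> reachable (with_proj G) s t)"

end

theory Submission
  imports Defs
begin

text \<open>
  Every strongly connected component is spanned by an in-tree and an out-tree, at the cost of at
  most \<open>2 n\<close> arcs \<open>T\<close>. Add a minimal set \<open>F\<close> of arcs making \<open>T \<union> F\<close> a preserver, and assign to
  each arc of \<open>F\<close> a pair for which it is essential. Consider the incidences between the components
  of the tails of arcs in \<open>F\<close> and the assigned pairs. Arcs assigned to the same pair are linearly
  ordered along a path, so in any cycle of length 4 or 6 of the incidence graph some path could be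
  rerouted around one of its essential arcs. Hence the incidence graph has girth at least 8, so its
  ends determine a path of length 3 from a component to a pair, and there are at most \<open>n |P|\<close> of
  these; with \<open>e\<close> incidences there are at least of order \<open>e\<^sup>3 / (n |P|)\<close> of them unless
  \<open>e = O(n + |P|)\<close>. Finally \<open>|P| \<le> n\<^sup>2\<close> gives \<open>|P| \<le> (n |P|)\<^sup>2\<^sup>/\<^sup>3\<close>.
\<close>

lemma powr_two_thirds_ge:
  fixes x y c :: real
  assumes "0 \<le> x" "0 \<le> y" "0 \<le> c" "x ^ 3 \<le> c ^ 3 * y ^ 2"
  shows "x \<le> c * y powr (2 / 3)"
proof (rule power_le_imp_le_base[where n = 2])
  have "(y powr (2/3)) ^ 3 = y ^ 2"
  proof (cases "y = 0")
    case False
    then have "(y powr (2/3)) ^ 3 = y powr (2/3 * 3)"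
      by (subst powr_power) auto
    also have "\<dots> = y ^ 2"
      using False assms(2) powr_realpow[of y 2] by simp
    finally show ?thesis .
  qed simp
  then show "x ^ Suc 2 \<le> (c * y powr (2/3)) ^ Suc 2"
    using assms(4) by (simp add: power_mult_distrib flip: numeral_3_eq_3)
qed (use assms in simp)

section \<open>Incidence structures without short cycles\<close>

text \<open>A path of length 3 from a point of \<open>X\<close> to a point of \<open>Q\<close> is
  determined by its ends, since two such paths would close up to a cycle of length 4 or 6. Comparing
  this upper bound on the number of paths with a lower bound from degrees bounds
  \<open>card I\<close>.\<close>

lemma card_cycle_free_incidences:
  fixes I :: "('x \<times> 'q) set"
  assumes fin: "finite X" "finite Q" and I: "I \<subseteq> X \<times> Q"
    and no4: "\<And>x y p q. \<lbrakk>(x, p) \<in> I; (y, p) \<in> I; (x, q) \<in> I; (y, q) \<in> I; x \<noteq> y\<rbrakk> \<Longrightarrow> p = q"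
    and no6: "\<And>x y z p q r. \<lbrakk>(x, p) \<in> I; (y, p) \<in> I; (y, q) \<in> I; (z, q) \<in> I; (z, r) \<in> I; (x, r) \<in> I;
                 x \<noteq> y; y \<noteq> z; x \<noteq> z; p \<noteq> q; q \<noteq> r; p \<noteq> r\<rbrakk> \<Longrightarrow> False"
  shows "real (card I)
    \<le> 8 * real (card X) + 8 * real (card Q) + 6 * (real (card X) * real (card Q)) powr (2 / 3)"
\<comment> \<open>The linear terms cover the case of small average degree on either side. Otherwise
  both averages exceed 8, so losing 1 from a quarter of an average costs at most half of it.\<close>
proof (cases "real (card I) \<le> 8 * real (card X) \<or> real (card I) \<le> 8 * real (card Q)")
  case True
  moreover have "0 \<le> (real (card X) * real (card Q)) powr (2 / 3)" by simp
  ultimately show ?thesis by linarith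
next
  case False
  define n p e where "n = real (card X)" and "p = real (card Q)" and "e = real (card I)"
  have big: "8 * n < e" "8 * p < e" using False by (auto simp: n_def p_def e_def)
  have finI: "finite I" using fin I by (meson finite_SigmaI finite_subset)
  have "I \<noteq> {}" using big(1) by (auto simp: e_def n_def)
  then have pos: "0 < n" "0 < p" using I fin by (auto simp: n_def p_def card_gt_0_iff)
  define A where "A q = {x. (x, q) \<in> I}" for q
  define B where "B x = {q. (x, q) \<in> I}" for x
  have finA: "finite (A q)" for q
    by (rule finite_subset[OF _ fin(1)]) (use I in \<open>auto simp: A_def\<close>)
  have finB: "finite (B x)" for x
    by (rule finite_subset[OF _ fin(2)]) (use I in \<open>auto simp: B_def\<close>)
  \<comment> \<open>An element \<open>((x, q), (z, r))\<close> encodes the path z - q - x - r with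
    middle edge \<open>(x, q)\<close>.\<close>
  define W where "W = (SIGMA i:I. (A (snd i) - {fst i}) \<times> (B (fst i) - {snd i}))"
  have "inj_on snd W"
  proof (rule inj_onI)
    fix u v assume uv: "u \<in> W" "v \<in> W" "snd u = snd v"
    obtain x q z r where u: "u = ((x, q), (z, r))" by (metis surj_pair)
    obtain x' q' where v: "v = ((x', q'), (z, r))" using uv(3) u by (metis snd_conv surj_pair)
    have a: "(x, q) \<in> I" "(z, q) \<in> I" "(x, r) \<in> I" "z \<noteq> x" "r \<noteq> q"
      using uv(1) by (auto simp: u W_def A_def B_def)
    have b: "(x', q') \<in> I" "(z, q') \<in> I" "(x', r) \<in> I" "z \<noteq> x'" "r \<noteq> q'"
      using uv(2) by (auto simp: v W_def A_def B_def)
    have "x = x' \<Longrightarrow> q = q'" using no4[of x q z q'] a b by blast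
    moreover have "q = q' \<Longrightarrow> x = x'" using no4[of x q x' r] a b by blast
    \<comment> \<open>Otherwise z - q - x - r - x' - q' - z is a 6-cycle.\<close>
    moreover have "x = x' \<or> q = q'" using no6[of z q x r x' q'] a b by blast
    ultimately show "u = v" using u v by blast
  qed
  moreover have "snd ` W \<subseteq> X \<times> Q" using I by (auto simp: W_def A_def B_def)
  ultimately have "card W \<le> card (X \<times> Q)"
    using fin by (intro card_inj_on_le[of snd]) auto
  then have "real (card W) \<le> real (card (X \<times> Q))" by linarith
  then have W_le: "real (card W) \<le> n * p" by (simp add: card_cartesian_product n_def p_def)
  have W_eq: "real (card W) =
      (\<Sum>i\<in>I. (real (card (A (snd i))) - 1) * (real (card (B (fst i))) - 1))" (is "_ = sum ?g I")
  proof -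
    have *: "real (card (A (snd i) - {fst i}) * card (B (fst i) - {snd i})) = ?g i" if "i \<in> I" for i
    proof -
      have "fst i \<in> A (snd i)" "snd i \<in> B (fst i)" using that by (auto simp: A_def B_def)
      then have "real (card (A (snd i) - {fst i})) = real (card (A (snd i))) - 1"
        "real (card (B (fst i) - {snd i})) = real (card (B (fst i))) - 1"
        using finA finB by (metis card_Suc_Diff1 add_diff_cancel_left' of_nat_Suc)+
      then show ?thesis by simp
    qed
    have "card W = (\<Sum>i\<in>I. card (A (snd i) - {fst i}) * card (B (fst i) - {snd i}))"
      unfolding W_def using finI finA finB by (subst card_SigmaI) (auto simp: card_cartesian_product)
    then show ?thesis using * by (simp del: of_nat_mult)
  qed
  \<comment> \<open>\<open>L\<close> and \<open>M\<close> collect the incidences at a point whose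
    degree is below a quarter of the average on its side. Each contains at most \<open>e / 4\<close>
    incidences, so at least half of \<open>I\<close> survives.\<close>
  define L where "L = {i \<in> I. real (card (A (snd i))) < e / (4 * p)}"
  define M where "M = {i \<in> I. real (card (B (fst i))) < e / (4 * n)}"
  have "L \<subseteq> (\<Union>q\<in>{q \<in> Q. real (card (A q)) < e / (4 * p)}. A q \<times> {q})" (is "_ \<subseteq> ?U")
    using I by (auto simp: L_def A_def)
  then have "card L \<le> card ?U" using fin finA by (intro card_mono) auto
  also have "\<dots> \<le> (\<Sum>q\<in>{q \<in> Q. real (card (A q)) < e / (4 * p)}. card (A q \<times> {q}))"
    using fin by (intro card_UN_le) auto
  finally have "real (card L) \<le> (\<Sum>q\<in>{q \<in> Q. real (card (A q)) < e / (4 * p)}. real (card (A q)))"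
    by (simp add: card_cartesian_product flip: of_nat_sum)
  also have "\<dots> \<le> (\<Sum>q\<in>{q \<in> Q. real (card (A q)) < e / (4 * p)}. e / (4 * p))"
    by (intro sum_mono) auto
  also have "\<dots> \<le> (\<Sum>q\<in>Q. e / (4 * p))"
    using fin pos by (intro sum_mono2) (auto simp: e_def)
  also have "\<dots> = e / 4" using pos by (simp add: p_def)
  finally have L: "real (card L) \<le> e / 4" .
  have "M \<subseteq> (\<Union>x\<in>{x \<in> X. real (card (B x)) < e / (4 * n)}. {x} \<times> B x)" (is "_ \<subseteq> ?U'")
    using I by (auto simp: M_def B_def)
  then have "card M \<le> card ?U'" using fin finB by (intro card_mono) auto
  also have "\<dots> \<le> (\<Sum>x\<in>{x \<in> X. real (card (B x)) < e / (4 * n)}. card ({x} \<times> B x))"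
    using fin by (intro card_UN_le) auto
  finally have "real (card M) \<le> (\<Sum>x\<in>{x \<in> X. real (card (B x)) < e / (4 * n)}. real (card (B x)))"
    by (simp add: card_cartesian_product flip: of_nat_sum)
  also have "\<dots> \<le> (\<Sum>x\<in>{x \<in> X. real (card (B x)) < e / (4 * n)}. e / (4 * n))"
    by (intro sum_mono) auto
  also have "\<dots> \<le> (\<Sum>x\<in>X. e / (4 * n))"
    using fin pos by (intro sum_mono2) (auto simp: e_def)
  also have "\<dots> = e / 4" using pos by (simp add: n_def)
  finally have M: "real (card M) \<le> e / 4" .
  have "card I \<le> card (I - (L \<union> M)) + card (L \<union> M)"
    using card_mono[of "I - (L \<union> M) \<union> (L \<union> M)" I] card_Un_le[of "I - (L \<union> M)" "L \<union> M"] finI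
    by (auto simp: L_def M_def)
  also have "card (L \<union> M) \<le> card L + card M" by (rule card_Un_le)
  finally have rest: "e / 2 \<le> real (card (I - (L \<union> M)))" using L M by (simp add: e_def)
  \<comment> \<open>Every surviving incidence is the middle of at least
    \<open>e / (8 * p) * (e / (8 * n))\<close> paths. The factors 2, 8 and 8 give the 128 below, and
    6 is the least integer whose cube exceeds it.\<close>
  have "e / 2 * (e / (8 * p) * (e / (8 * n))) \<le> real (card (I - (L \<union> M))) * (e / (8 * p) * (e / (8 * n)))"
    using rest pos by (intro mult_right_mono) (auto simp: e_def)
  also have "\<dots> = (\<Sum>i\<in>I - (L \<union> M). e / (8 * p) * (e / (8 * n)))" by simp
  also have "\<dots> \<le> sum ?g (I - (L \<union> M))"
  proof (rule sum_mono)
    fix i assume "i \<in> I - (L \<union> M)"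
    then have "e / (4 * p) \<le> real (card (A (snd i)))" "e / (4 * n) \<le> real (card (B (fst i)))"
      by (auto simp: L_def M_def)
    moreover have "1 \<le> e / (8 * p)" "1 \<le> e / (8 * n)" using big pos by (auto simp: field_simps)
    moreover have "e / (4 * p) = 2 * (e / (8 * p))" "e / (4 * n) = 2 * (e / (8 * n))" by simp_all
    ultimately show "e / (8 * p) * (e / (8 * n)) \<le> ?g i"
      by (intro mult_mono) linarith+
  qed
  also have "\<dots> \<le> sum ?g I"
  proof (rule sum_mono2)
    fix i assume "i \<in> I - (I - (L \<union> M))"
    then have "fst i \<in> A (snd i)" "snd i \<in> B (fst i)" by (auto simp: L_def M_def A_def B_def)
    then have "0 < card (A (snd i))" "0 < card (B (fst i))"
      using finA finB by (auto simp: card_gt_0_iff)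
    then show "0 \<le> ?g i" by simp
  qed (use finI in auto)
  also have "\<dots> \<le> n * p" using W_le W_eq by simp
  finally have "e ^ 3 \<le> 128 * (n * p) ^ 2"
    using pos by (simp add: field_simps power2_eq_square power3_eq_cube)
  also have "\<dots> \<le> 6 ^ 3 * (n * p) ^ 2" by simp
  finally have "e \<le> 6 * (n * p) powr (2 / 3)"
    using pos by (intro powr_two_thirds_ge) (auto simp: e_def)
  then show ?thesis using pos unfolding e_def n_def p_def by linarith
qed

section \<open>Sparse strongly connected skeletons\<close>

text \<open>Each vertex that reaches its root \<open>r x\<close> keeps one arc, the first arc of a
  shortest path to the root. The hypothesis on \<open>r\<close> says that the next vertex has the
  same root, so following kept arcs decreases the distance.\<close>

lemma sparse_in_forest:
  assumes "finite V" "E \<subseteq> V \<times> V"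
    and r: "\<And>x y. (x, y) \<in> E \<Longrightarrow> (y, r x) \<in> E\<^sup>* \<Longrightarrow> r y = r x"
  shows "\<exists>T\<subseteq>E. card T \<le> card V \<and> (\<forall>x. (x, r x) \<in> E\<^sup>* \<longrightarrow> (x, r x) \<in> T\<^sup>*)"
proof -
  define d where "d x = (LEAST k. (x, r x) \<in> E ^^ k)" for x
  have d: "(x, r x) \<in> E ^^ d x" if "(x, r x) \<in> E\<^sup>*" for x
    unfolding d_def using that by (meson LeastI rtrancl_imp_relpow)
  \<comment> \<open>When \<open>d x = 0\<close> the truncated subtraction admits at most a loop at
    the root, which still counts as the one arc of that vertex.\<close>
  define good where "good x y \<longleftrightarrow> (x, y) \<in> E \<and> (y, r x) \<in> E ^^ (d x - 1)" for x y
  define T where "T = {(x, SOME y. good x y) | x. \<exists>y. good x y}"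
  have some: "good x (SOME y. good x y)" if "\<exists>y. good x y" for x
    using that by (rule someI_ex)
  have "T \<subseteq> E" using some by (auto simp: T_def good_def)
  moreover have "card T \<le> card V"
  proof -
    have "T \<subseteq> (\<lambda>x. (x, SOME y. good x y)) ` V"
      using assms(2) by (auto simp: T_def good_def)
    then show ?thesis using assms(1) by (meson card_image_le card_mono finite_imageI le_trans)
  qed
  moreover have "(x, r x) \<in> T\<^sup>*" if "(x, r x) \<in> E\<^sup>*" for x
    using that
  proof (induction "d x" arbitrary: x rule: less_induct)
    case less
    show ?case
    proof (cases "d x")
      case 0
      then show ?thesis using d[OF less.prems] by simp
    next
      case (Suc k)
      then have "\<exists>y. good x y"
        using d[OF less.prems] unfolding good_def by (metis diff_Suc_1 relpow_Suc_D2)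
      then obtain y where y: "good x y" "(x, y) \<in> T" using some by (auto simp: T_def)
      then have y': "(x, y) \<in> E" "(y, r x) \<in> E ^^ k" using Suc by (auto simp: good_def)
      then have "(y, r x) \<in> E\<^sup>*" by (simp add: relpow_imp_rtrancl)
      with r y' have ry: "r y = r x" by blast
      then have "d y \<le> k" unfolding d_def using y' by (intro Least_le) simp
      then have "(y, r y) \<in> T\<^sup>*" using less.hyps[of y] Suc ry \<open>(y, r x) \<in> E\<^sup>*\<close> by simp
      then show ?thesis using y(2) ry by (simp add: converse_rtrancl_into_rtrancl)
    qed
  qed
  ultimately show ?thesis by blast
qed

definition scc :: "'a rel \<Rightarrow> 'a \<Rightarrow> 'a set" where
  "scc E x = {y. (x, y) \<in> E\<^sup>* \<and> (y, x) \<in> E\<^sup>*}"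

lemma scc_eq_iff: "scc E x = scc E y \<longleftrightarrow> (x, y) \<in> E\<^sup>* \<and> (y, x) \<in> E\<^sup>*"
proof
  assume "scc E x = scc E y"
  then have "x \<in> scc E y" by (auto simp: scc_def)
  then show "(x, y) \<in> E\<^sup>* \<and> (y, x) \<in> E\<^sup>*" by (simp add: scc_def)
next
  assume "(x, y) \<in> E\<^sup>* \<and> (y, x) \<in> E\<^sup>*"
  then show "scc E x = scc E y" unfolding scc_def by (blast intro: rtrancl_trans)
qed

text \<open>With one representative per component, an in-forest leads from \<open>x\<close> to the
  representative, and an in-forest of the converse relation, read backwards, leads from there to
  \<open>y\<close>.\<close>

lemma sparse_scc_skeleton:
  assumes "finite V" "E \<subseteq> V \<times> V"
  shows "\<exists>T\<subseteq>E. card T \<le> 2 * card V \<and> (\<forall>x y. scc E x = scc E y \<longrightarrow> (x, y) \<in> T\<^sup>*)"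
proof -
  define r where "r x = (SOME y. y \<in> scc E x)" for x
  have "r x \<in> scc E x" for x
    unfolding r_def by (rule someI[of _ x]) (simp add: scc_def)
  then have r: "(x, r x) \<in> E\<^sup>*" "(r x, x) \<in> E\<^sup>*" for x by (auto simp: scc_def)
  have r_eq: "r x = r y" if "scc E x = scc E y" for x y
    using that by (simp add: r_def)
  \<comment> \<open>Such an arc lies on a closed walk through \<open>r x\<close>, so its ends share
    a component.\<close>
  have "r y = r x" if "(x, y) \<in> E" "(y, r x) \<in> E\<^sup>*" for x y
    using that r by (intro r_eq) (meson scc_eq_iff r_into_rtrancl rtrancl_trans)
  then obtain T1 where T1: "T1 \<subseteq> E" "card T1 \<le> card V" "\<And>x. (x, r x) \<in> T1\<^sup>*"
    using sparse_in_forest[OF assms, of r] r by blast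
  have "r y = r x" if "(y, x) \<in> E" "(r x, y) \<in> E\<^sup>*" for x y
    using that r by (intro r_eq) (meson scc_eq_iff r_into_rtrancl rtrancl_trans)
  then obtain T2 where T2: "T2 \<subseteq> E\<inverse>" "card T2 \<le> card V" "\<And>x. (x, r x) \<in> T2\<^sup>*"
    using sparse_in_forest[of V "E\<inverse>" r] assms r by (auto simp: rtrancl_converse)
  have "T1 \<union> T2\<inverse> \<subseteq> E" using T1(1) T2(1) by auto
  moreover have "card (T1 \<union> T2\<inverse>) \<le> 2 * card V"
    using card_Un_le[of T1 "T2\<inverse>"] T1(2) T2(2) by (simp add: card_inverse)
  moreover have "(x, y) \<in> (T1 \<union> T2\<inverse>)\<^sup>*" if "scc E x = scc E y" for x y
  proof -
    have "(x, r x) \<in> (T1 \<union> T2\<inverse>)\<^sup>*" using T1(3) rtrancl_mono by blast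
    moreover have "(r y, y) \<in> (T2\<inverse>)\<^sup>*" using T2(3) by (simp add: rtrancl_converse)
    then have "(r y, y) \<in> (T1 \<union> T2\<inverse>)\<^sup>*" using rtrancl_mono by blast
    ultimately show ?thesis using r_eq[OF that] by (metis rtrancl_trans)
  qed
  ultimately show ?thesis by blast
qed

section \<open>Essential arcs\<close>

text \<open>Cut a path through \<open>e\<close> before its first and after its last use of
  \<open>e\<close>.\<close>

lemma rtrancl_remove_arc:
  assumes "(x, y) \<in> R\<^sup>*" "R \<subseteq> insert e R'"
  shows "(x, y) \<in> R'\<^sup>* \<or> (x, fst e) \<in> R'\<^sup>* \<and> (snd e, y) \<in> R'\<^sup>*"
proof -
  have "(x, y) \<in> (insert (fst e, snd e) R')\<^sup>*" using assms rtrancl_mono by auto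
  then show ?thesis unfolding rtrancl_insert by auto
qed

text \<open>Every path for the pair \<open>q e\<close> must use \<open>e\<close>, so each
  contradiction below exhibits a detour around some \<open>e\<close>. Such detours may move freely
  inside components of \<open>R\<close>, because \<open>T\<close> does not depend on the arcs of
  \<open>F\<close>.\<close>

locale essential_arcs =
  fixes R T F :: "'a rel" and q :: "'a \<times> 'a \<Rightarrow> 'a \<times> 'a"
  assumes sub: "T \<subseteq> R" "F \<subseteq> R"
    and skeleton: "scc R x = scc R y \<Longrightarrow> (x, y) \<in> T\<^sup>*"
    and connected: "e \<in> F \<Longrightarrow> q e \<in> (T \<union> F)\<^sup>*"
    and essential: "e \<in> F \<Longrightarrow> q e \<notin> (T \<union> (F - {e}))\<^sup>*"
begin

text \<open>The relation compares arcs assigned to arbitrary pairs. On \<open>F\<close> it turns out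
  to be a strict partial order, and a linear one among the arcs of a single pair.\<close>

definition precedes :: "'a \<times> 'a \<Rightarrow> 'a \<times> 'a \<Rightarrow> bool"  (infix "\<prec>" 50) where
  "e \<prec> f \<longleftrightarrow> (snd e, fst f) \<in> (T \<union> F)\<^sup>*"

lemma avoid_mono: "(x, y) \<in> T\<^sup>* \<Longrightarrow> (x, y) \<in> (T \<union> A)\<^sup>*"
  using rtrancl_mono[of T "T \<union> A"] by blast

lemma in_R: "(x, y) \<in> (T \<union> F)\<^sup>* \<Longrightarrow> (x, y) \<in> R\<^sup>*"
  using sub rtrancl_mono[of "T \<union> F" R] by blast

lemma arc_in_avoid: "f \<in> F \<Longrightarrow> f \<noteq> e \<Longrightarrow> (fst f, snd f) \<in> (T \<union> (F - {e}))\<^sup>*"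
  by (cases f) auto

lemma avoid_or_through:
  assumes "(x, y) \<in> (T \<union> F)\<^sup>*"
  shows "(x, y) \<in> (T \<union> (F - {e}))\<^sup>* \<or> (x, fst e) \<in> (T \<union> (F - {e}))\<^sup>* \<and> (snd e, y) \<in> (T \<union> (F - {e}))\<^sup>*"
  by (rule rtrancl_remove_arc[OF assms]) auto

lemma avoid_subset: "(x, y) \<in> (T \<union> (F - {e}))\<^sup>* \<Longrightarrow> (x, y) \<in> (T \<union> F)\<^sup>*"
  using rtrancl_mono[of "T \<union> (F - {e})" "T \<union> F"] by blast

lemma split_at_essential:
  assumes "e \<in> F" "q e = (s, t)"
  shows "(s, fst e) \<in> (T \<union> (F - {e}))\<^sup>*" "(snd e, t) \<in> (T \<union> (F - {e}))\<^sup>*"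
  using avoid_or_through[of s t e] connected[OF assms(1)] essential[OF assms(1)] assms(2) by auto

text \<open>A return path would put both ends of \<open>e\<close> into one component, where
  \<open>T\<close> bypasses \<open>e\<close>.\<close>

lemma not_return:
  assumes "e \<in> F"
  shows "(snd e, fst e) \<notin> R\<^sup>*"
proof
  assume cycle: "(snd e, fst e) \<in> R\<^sup>*"
  obtain s t where st: "q e = (s, t)" by force
  have "(fst e, snd e) \<in> R" using assms sub by auto
  with cycle have "scc R (fst e) = scc R (snd e)" by (auto simp: scc_eq_iff)
  then have "(fst e, snd e) \<in> (T \<union> (F - {e}))\<^sup>*" by (intro avoid_mono skeleton)
  then have "(s, t) \<in> (T \<union> (F - {e}))\<^sup>*"
    using split_at_essential[OF assms st] by (meson rtrancl_trans)
  then show False using essential[OF assms] st by simp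
qed

text \<open>\<open>T\<close> joins the two tails. This is why an incidence needs to record only the
  component of the tail.\<close>

lemma precedes_scc: "e \<prec> f \<Longrightarrow> scc R (fst f) = scc R (fst g) \<Longrightarrow> e \<prec> g"
  unfolding precedes_def by (meson avoid_mono skeleton rtrancl_trans)

lemma precedes_trans: "e \<prec> f \<Longrightarrow> f \<in> F \<Longrightarrow> f \<prec> g \<Longrightarrow> e \<prec> g"
  unfolding precedes_def
  by (metis UnI2 prod.collapse r_into_rtrancl rtrancl_trans)

lemma not_precedes_scc: "e \<in> F \<Longrightarrow> scc R (fst e) = scc R (fst f) \<Longrightarrow> \<not> e \<prec> f"
  using precedes_scc[of e f e] not_return[of e] in_R unfolding precedes_def by metis

text \<open>If the arcs were incomparable, a path for the common pair through \<open>e\<close> could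
  meet \<open>f\<close> neither before nor after \<open>e\<close>, although \<open>f\<close> is
  essential.\<close>

lemma precedes_linear:
  assumes "e \<in> F" "f \<in> F" "e \<noteq> f" "q e = q f"
  shows "e \<prec> f \<or> f \<prec> e"
proof (rule ccontr)
  assume no: "\<not> (e \<prec> f \<or> f \<prec> e)"
  obtain s t where st: "q e = (s, t)" by force
  have "(s, fst e) \<in> (T \<union> (F - {f}))\<^sup>*"
    using split_at_essential[OF assms(1) st] avoid_or_through[of s "fst e" f] no avoid_subset
    unfolding precedes_def by meson
  moreover have "(snd e, t) \<in> (T \<union> (F - {f}))\<^sup>*"
    using split_at_essential[OF assms(1) st] avoid_or_through[of "snd e" t f] no avoid_subset
    unfolding precedes_def by meson
  ultimately have "(s, t) \<in> (T \<union> (F - {f}))\<^sup>*"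
    using arc_in_avoid[OF assms(1,3)] by (meson rtrancl_trans)
  then show False using essential[OF assms(2)] assms(4) st by simp
qed

text \<open>Otherwise one could reach the tail of \<open>e\<close>, move inside its component to the
  tail of \<open>f\<close>, and continue through \<open>f\<close> and \<open>e'\<close> to the
  target. No section of this route uses \<open>e\<close>, since that would make \<open>f\<close> or
  \<open>e'\<close> precede \<open>e\<close>.\<close>

lemma no_bypass:
  assumes "e \<in> F" "e' \<in> F" "f \<in> F" "q e = q e'" "q f \<noteq> q e" "e \<prec> e'"
    and scc: "scc R (fst f) = scc R (fst e)"
  shows "\<not> f \<prec> e'"
proof
  assume fe': "f \<prec> e'"
  obtain s t where st: "q e = (s, t)" by force
  have "\<not> e' \<prec> e"
    using assms precedes_trans not_precedes_scc by blast
  then have "e' \<noteq> e" "(snd e', t) \<in> (T \<union> (F - {e}))\<^sup>*"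
    using assms avoid_or_through[of "snd e'" t e] split_at_essential[OF assms(2)] st avoid_subset
    unfolding precedes_def by metis+
  moreover have "(fst e, fst f) \<in> (T \<union> (F - {e}))\<^sup>*"
    using scc by (intro avoid_mono skeleton) simp
  moreover have "(fst f, snd f) \<in> (T \<union> (F - {e}))\<^sup>*"
    using assms by (intro arc_in_avoid) auto
  moreover have "\<not> f \<prec> e" using assms not_precedes_scc by blast
  then have "(snd f, fst e') \<in> (T \<union> (F - {e}))\<^sup>*"
    using fe' avoid_or_through[of "snd f" "fst e'" e] avoid_subset unfolding precedes_def by metis
  moreover have "(fst e', snd e') \<in> (T \<union> (F - {e}))\<^sup>*"
    using assms \<open>e' \<noteq> e\<close> by (intro arc_in_avoid) auto
  ultimately have "(s, t) \<in> (T \<union> (F - {e}))\<^sup>*"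
    using split_at_essential(1)[OF assms(1) st] by (meson rtrancl_trans)
  then show False using essential[OF assms(1)] st by simp
qed

text \<open>Arcs of one pair are comparable, but arcs with tails in one component are not. Hence the
  map from arcs of \<open>F\<close> to incidences is injective.\<close>

lemma scc_neq:
  assumes "e \<in> F" "f \<in> F" "e \<noteq> f" "q e = q f"
  shows "scc R (fst e) \<noteq> scc R (fst f)"
  using precedes_linear[OF assms] not_precedes_scc assms by metis

section \<open>Excluding short cycles among the incidences\<close>

text \<open>Let \<open>e1\<close> precede \<open>e2\<close>. If the other pair runs in the same
  direction, \<open>f1\<close> bypasses \<open>e1\<close>; if it runs in the opposite direction, the
  two pairs lead from \<open>e1\<close> back to its own component.\<close>

lemma no_4_cycle:
  assumes "e1 \<in> F" "e2 \<in> F" "f1 \<in> F" "f2 \<in> F" "q e1 = q e2" "q f1 = q f2"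
    and "scc R (fst e1) = scc R (fst f1)" "scc R (fst e2) = scc R (fst f2)"
    and "scc R (fst e1) \<noteq> scc R (fst e2)"
  shows "q e1 = q f1"
proof (rule ccontr)
  assume ne: "q e1 \<noteq> q f1"
  have *: False
    if "e1 \<in> F" "e2 \<in> F" "f1 \<in> F" "f2 \<in> F" "q e1 = q e2" "q f1 = q f2" "q e1 \<noteq> q f1"
      "scc R (fst e1) = scc R (fst f1)" "scc R (fst e2) = scc R (fst f2)"
      "scc R (fst e1) \<noteq> scc R (fst e2)" "e1 \<prec> e2" for e1 e2 f1 f2
  proof -
    have "f1 \<prec> f2 \<or> f2 \<prec> f1" using that by (intro precedes_linear) auto
    then show False
    proof
      assume "f1 \<prec> f2"
      then have "f1 \<prec> e2" using that precedes_scc by metis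
      then show False using no_bypass[of e1 e2 f1] that by auto
    next
      assume "f2 \<prec> f1"
      moreover have "e1 \<prec> f2" using that precedes_scc by metis
      ultimately have "e1 \<prec> f1" using that precedes_trans by metis
      then show False using that not_precedes_scc by metis
    qed
  qed
  have "e1 \<prec> e2 \<or> e2 \<prec> e1" using assms by (intro precedes_linear) auto
  then show False
    using *[of e1 e2 f1 f2] *[of e2 e1 f2 f1] assms ne by metis
qed

text \<open>This is the acyclic orientation of a 6-cycle: the chain through \<open>f\<close> and
  \<open>g\<close> ends in the component of the tail of \<open>e'\<close>, so \<open>f\<close>
  bypasses \<open>e\<close>.\<close>

lemma no_3_bridge:
  assumes "e \<in> F" "e' \<in> F" "f \<in> F" "f' \<in> F" "g \<in> F" "g' \<in> F"
    and "q e = q e'" "q f = q f'" "q g = q g'" "q e \<noteq> q f"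
    and "e \<prec> e'" "f \<prec> f'" "g \<prec> g'"
    and "scc R (fst e) = scc R (fst f)" "scc R (fst f') = scc R (fst g)" "scc R (fst g') = scc R (fst e')"
  shows False
proof -
  have "f \<prec> g" using assms precedes_scc by metis
  then have "f \<prec> g'" using assms precedes_trans by metis
  then have "f \<prec> e'" using assms precedes_scc by metis
  then show False using no_bypass[of e e' f] assms by auto
qed

text \<open>This is the cyclic orientation of a 6-cycle: going around leads from \<open>e\<close>
  back to the component of its tail.\<close>

lemma no_directed_triangle:
  assumes "e \<in> F" "f \<in> F" "g \<in> F" "e \<prec> e'" "f \<prec> f'" "g \<prec> g'"
    and "scc R (fst e') = scc R (fst f)" "scc R (fst f') = scc R (fst g)" "scc R (fst g') = scc R (fst e)"
  shows False
proof -
  have "e \<prec> f" using assms precedes_scc by metis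
  then have "e \<prec> f'" using assms precedes_trans by metis
  then have "e \<prec> g" using assms precedes_scc by metis
  then have "e \<prec> g'" using assms precedes_trans by metis
  then show False using assms not_precedes_scc by metis
qed

lemma no_6_cycle:
  assumes F: "e1 \<in> F" "e2 \<in> F" "f2 \<in> F" "f3 \<in> F" "g3 \<in> F" "g1 \<in> F"
    and q: "q e1 = q e2" "q f2 = q f3" "q g3 = q g1" "q e1 \<noteq> q f2" "q f2 \<noteq> q g3" "q e1 \<noteq> q g3"
    and s: "scc R (fst e1) = scc R (fst g1)" "scc R (fst e2) = scc R (fst f2)" "scc R (fst f3) = scc R (fst g3)"
    and ne: "scc R (fst e1) \<noteq> scc R (fst e2)" "scc R (fst f2) \<noteq> scc R (fst f3)" "scc R (fst g3) \<noteq> scc R (fst g1)"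
  shows False
proof -
  have "e1 \<prec> e2 \<or> e2 \<prec> e1" "f2 \<prec> f3 \<or> f3 \<prec> f2" "g3 \<prec> g1 \<or> g1 \<prec> g3"
    using F q ne by (intro precedes_linear; metis)+
  \<comment> \<open>The first and last of the eight orientations are cyclic. Each other one has a
    source and a sink component, and the pair joining them directly is the one that gets
    bypassed.\<close>
  then consider "e1 \<prec> e2" "f2 \<prec> f3" "g3 \<prec> g1" | "e1 \<prec> e2" "f2 \<prec> f3" "g1 \<prec> g3"
    | "e1 \<prec> e2" "f3 \<prec> f2" "g3 \<prec> g1" | "e1 \<prec> e2" "f3 \<prec> f2" "g1 \<prec> g3"
    | "e2 \<prec> e1" "f2 \<prec> f3" "g3 \<prec> g1" | "e2 \<prec> e1" "f2 \<prec> f3" "g1 \<prec> g3"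
    | "e2 \<prec> e1" "f3 \<prec> f2" "g3 \<prec> g1" | "e2 \<prec> e1" "f3 \<prec> f2" "g1 \<prec> g3"
    by blast
  then show False
  proof cases
    case 1
    then show ?thesis using no_directed_triangle[of e1 f2 g3 e2 f3 g1] F s by simp
  next
    case 2
    then show ?thesis using no_3_bridge[of g1 g3 e1 e2 f2 f3] F q s by simp
  next
    case 3
    then show ?thesis using no_3_bridge[of f3 f2 g3 g1 e1 e2] F q s by simp
  next
    case 4
    then show ?thesis using no_3_bridge[of e1 e2 g1 g3 f3 f2] F q s by simp
  next
    case 5
    then show ?thesis using no_3_bridge[of e2 e1 f2 f3 g3 g1] F q s by simp
  next
    case 6
    then show ?thesis using no_3_bridge[of f2 f3 e2 e1 g1 g3] F q s by simp
  next
    case 7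
    then show ?thesis using no_3_bridge[of g3 g1 f3 f2 e2 e1] F q s by simp
  next
    case 8
    then show ?thesis using no_directed_triangle[of g1 f3 e2 g3 f2 e1] F s by simp
  qed
qed

lemma card_essential_arcs:
  assumes "finite V" "finite P" "F \<subseteq> V \<times> V" "q ` F \<subseteq> P"
  shows "real (card F) \<le> 8 * real (card V) + 8 * real (card P)
    + 6 * (real (card V) * real (card P)) powr (2 / 3)"
proof -
  define c where "c e = (scc R (fst e), q e)" for e
  have "inj_on c F" using scc_neq unfolding c_def inj_on_def by blast
  then have "card F = card (c ` F)" by (simp add: card_image)
  also have "real (card (c ` F)) \<le> 8 * real (card (scc R ` V)) + 8 * real (card P)
      + 6 * (real (card (scc R ` V)) * real (card P)) powr (2 / 3)"
  proof (rule card_cycle_free_incidences)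
    show "c ` F \<subseteq> scc R ` V \<times> P" using assms(3,4) by (auto simp: c_def)
  next
    fix x y p r
    assume "(x, p) \<in> c ` F" "(y, p) \<in> c ` F" "(x, r) \<in> c ` F" "(y, r) \<in> c ` F" "x \<noteq> y"
    then show "p = r" unfolding c_def using no_4_cycle by (elim imageE Pair_inject) metis
  next
    fix x y z p r u
    assume I: "(x, p) \<in> c ` F" "(y, p) \<in> c ` F" "(y, r) \<in> c ` F" "(z, r) \<in> c ` F"
      "(z, u) \<in> c ` F" "(x, u) \<in> c ` F"
      and ne: "x \<noteq> y" "y \<noteq> z" "x \<noteq> z" "p \<noteq> r" "r \<noteq> u" "p \<noteq> u"
    from I(1) obtain e1 where "e1 \<in> F" "c e1 = (x, p)" by force
    moreover from I(2) obtain e2 where "e2 \<in> F" "c e2 = (y, p)" by force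
    moreover from I(3) obtain f2 where "f2 \<in> F" "c f2 = (y, r)" by force
    moreover from I(4) obtain f3 where "f3 \<in> F" "c f3 = (z, r)" by force
    moreover from I(5) obtain g3 where "g3 \<in> F" "c g3 = (z, u)" by force
    moreover from I(6) obtain g1 where "g1 \<in> F" "c g1 = (x, u)" by force
    ultimately show False using no_6_cycle[of e1 e2 f2 f3 g3 g1] ne by (simp add: c_def)
  qed (use assms in auto)
  also have "\<dots> \<le> 8 * real (card V) + 8 * real (card P)
      + 6 * (real (card V) * real (card P)) powr (2 / 3)"
    using card_image_le[OF assms(1), of "scc R"]
    by (intro add_mono mult_left_mono powr_mono2 mult_right_mono) auto
  finally show ?thesis .
qed

end

section \<open>From essential arcs to sparse preservers\<close>

lemma sparse_reachability:
  fixes E :: "'a rel"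
  assumes "finite V" "E \<subseteq> V \<times> V" "P \<subseteq> V \<times> V"
  shows "\<exists>D\<subseteq>E. P \<inter> E\<^sup>* \<subseteq> D\<^sup>* \<and>
    real (card D) \<le> 14 * (real (card V) + (real (card V) * real (card P)) powr (2 / 3))"
proof -
  have finE: "finite E" and finP: "finite P"
    using assms by (meson finite_SigmaI finite_subset)+
  obtain T where T: "T \<subseteq> E" "card T \<le> 2 * card V" "\<And>x y. scc E x = scc E y \<Longrightarrow> (x, y) \<in> T\<^sup>*"
    using sparse_scc_skeleton[OF assms(1,2)] by blast
  define ok where "ok F \<longleftrightarrow> F \<subseteq> E \<and> P \<inter> E\<^sup>* \<subseteq> (T \<union> F)\<^sup>*" for F
  have "ok E" using T(1) by (auto simp: ok_def Un_absorb1)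
  moreover have "finite {F. ok F}"
    by (rule finite_subset[of _ "Pow E"]) (use finE in \<open>auto simp: ok_def\<close>)
  ultimately obtain F where F: "ok F" and min: "\<And>F'. ok F' \<Longrightarrow> F' \<subseteq> F \<Longrightarrow> F' = F"
    using finite_has_minimal[of "{F. ok F}"] by (metis empty_iff mem_Collect_eq)
  \<comment> \<open>By minimality, deleting \<open>e\<close> disconnects some demanded pair;
    \<open>q e\<close> is chosen among these.\<close>
  have "\<exists>p. p \<in> P \<inter> E\<^sup>* \<and> p \<notin> (T \<union> (F - {e}))\<^sup>*" if "e \<in> F" for e
    using min[of "F - {e}"] F that unfolding ok_def by blast
  then obtain q where q: "\<And>e. e \<in> F \<Longrightarrow> q e \<in> P \<inter> E\<^sup>* \<and> q e \<notin> (T \<union> (F - {e}))\<^sup>*" by metis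
  interpret essential_arcs E T F q
    using T F q unfolding ok_def by unfold_locales blast+
  define w where "w = (real (card V) * real (card P)) powr (2 / 3)"
  have "real (card F) \<le> 8 * real (card V) + 8 * real (card P) + 6 * w"
    using assms finP F q unfolding ok_def w_def by (intro card_essential_arcs) auto
  moreover have "real (card P) \<le> 1 * w"
    unfolding w_def
  proof (rule powr_two_thirds_ge)
    have "card P \<le> card (V \<times> V)" using assms by (intro card_mono) auto
    then have "card P \<le> (card V)\<^sup>2" by (simp add: card_cartesian_product power2_eq_square)
    then have "real (card P) \<le> real (card V) ^ 2" by (metis of_nat_le_iff of_nat_power)
    then show "real (card P) ^ 3 \<le> 1 ^ 3 * (real (card V) * real (card P)) ^ 2"
      using mult_right_mono[of "real (card P)" "real (card V) ^ 2" "real (card P) ^ 2"]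
      by (simp add: power_mult_distrib power3_eq_cube power2_eq_square mult_ac)
  qed auto
  moreover have "real (card (T \<union> F)) \<le> 2 * real (card V) + real (card F)"
    using card_Un_le[of T F] T(2) by linarith
  \<comment> \<open>The total is at most \<open>2 + 8 = 10\<close> times \<open>card V\<close> plus
    \<open>8 + 6 = 14\<close> times \<open>w\<close>, the 8 coming from the term in
    \<open>card P\<close>.\<close>
  ultimately have "real (card (T \<union> F)) \<le> 14 * (real (card V) + w)"
    by (simp add: algebra_simps)
  then show ?thesis using F T(1) unfolding ok_def w_def by (intro exI[of _ "T \<union> F"]) simp
qed

text \<open>The hypothesis matters for the empty path: \<open>rtrancl\<close> is reflexive
  everywhere, \<open>reachable\<close> only at vertices.\<close>

lemma (in pair_wf_digraph) reachable_iff_rtrancl: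
  assumes "s \<in> pverts G"
  shows "reachable (with_proj G) s t \<longleftrightarrow> (s, t) \<in> (parcs G)\<^sup>*"
proof
  assume "(s, t) \<in> (parcs G)\<^sup>*"
  then show "reachable (with_proj G) s t"
  proof induction
    case (step y z)
    then show ?case by (auto intro: reachable_adj_trans)
  qed (use assms in auto)
qed (auto dest: reachable_rtranclI)

theorem theorem9:
  shows "\<exists>C::real. C > 0 \<and>
    (\<forall>(G :: 'a pair_pre_digraph) (P :: ('a \<times> 'a) set) (n :: nat).
       pair_fin_digraph G \<and> card (pverts G) = n \<and> P \<subseteq> pverts G \<times> pverts G \<longrightarrow>
       (\<exists>H :: 'a pair_pre_digraph. reachability_preserver G P H \<and>
          real (card (parcs H)) \<le> C * (real n + (real n * real (card P)) powr (2 / 3))))"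
proof (intro exI[of _ 14] conjI allI impI)
  fix G :: "'a pair_pre_digraph" and P :: "('a \<times> 'a) set" and n :: nat
  assume asm: "pair_fin_digraph G \<and> card (pverts G) = n \<and> P \<subseteq> pverts G \<times> pverts G"
  then interpret G: pair_fin_digraph G by simp
  have "parcs G \<subseteq> pverts G \<times> pverts G"
    using G.arc_fst_in_verts G.arc_snd_in_verts by fastforce
  then obtain D where D: "D \<subseteq> parcs G" "P \<inter> (parcs G)\<^sup>* \<subseteq> D\<^sup>*"
      "real (card D) \<le> 14 * (real n + (real n * real (card P)) powr (2 / 3))"
    using sparse_reachability[of "pverts G" "parcs G" P] asm G.pair_finite_verts by blast
  define H where "H = \<lparr>pverts = pverts G, parcs = D\<rparr>"
  interpret H: pair_wf_digraph H
    using D(1) G.arc_fst_in_verts G.arc_snd_in_verts by unfold_locales (simp_all add: H_def subset_eq)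
  have "spanning (with_proj H) (with_proj G)"
    unfolding spanning_def subgraph_def
    using D(1) G.wf_digraph_axioms H.wf_digraph_axioms by (auto simp: H_def)
  moreover have "reachable (with_proj H) s t \<longleftrightarrow> reachable (with_proj G) s t" if "(s, t) \<in> P" for s t
  proof -
    have "s \<in> pverts G" "s \<in> pverts H" using that asm by (auto simp: H_def)
    moreover have "(s, t) \<in> D\<^sup>* \<longleftrightarrow> (s, t) \<in> (parcs G)\<^sup>*"
      using D(1,2) that rtrancl_mono by blast
    ultimately show ?thesis
      using G.reachable_iff_rtrancl H.reachable_iff_rtrancl by (simp add: H_def)
  qed
  ultimately have "reachability_preserver G P H" by (auto simp: reachability_preserver_def)
  then show "\<exists>H. reachability_preserver G P H \<and>
      real (card (parcs H)) \<le> 14 * (real n + (real n * real (card P)) powr (2 / 3))"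
    using D(3) by (intro exI[of _ H]) (simp add: H_def)
qed simp

end
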